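(* Let $T$ be a perfect binary tree of height $h>0$ with vertex set $\{x_1,\dots,x_n\}$, let $S=\mathbb K[x_1,\dots,x_n]$ be the polynomial ring over a field $\mathbb K$, and let $I\subseteq S$ be the edge ideal of $T$. Then $$\dim(S/I)=\beta(T)=\frac{2^{h+3}-3+(-1)^{h}}{6},$$ where $\dim$ denotes Krull dimension and $\beta(T)$ is the independence number of $T$.
   Context: A perfect binary tree is a rooted tree in which every non-leaf vertex has exactly two children and all leaves lie at the same distance (number of edges) from the root; this common distance is the height $h$ of the tree. It is regarded as a finite simple graph. For a finite simple graph $G$ with vertices $x_1,\dots,x_n$ (identified with the variables of $S$), the edge ideal is $I(G)=(x_ix_j : \{x_i,x_j\}\in E(G))\subseteq S$. A subset of $V(G)$ is independent if no two of its vertices are adjacent; the independence number $\beta(G)$ is the largest cardinality of an independent set of $G$. *)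

theory Defs
  imports
    "HOL-Library.Poly_Mapping"
    "HOL-Algebra.QuotRing"
    "Graph_Theory.Graph_Theory"
begin

text \<open>
  A finite simple graph is a \<^locale>\<open>pair_graph\<close>: a finite, loop-free, symmetric digraph whose arcs
  are ordered pairs of vertices, an edge \<open>{u, v}\<close> being the pair of opposite arcs \<open>(u, v)\<close>, \<open>(v, u)\<close>.
\<close>

section \<open>Perfect binary trees\<close>

text \<open>
  The library's \<^const>\<open>tree\<close> is not suitable for symmetric digraphs, since there every edge already
  gives a directed cycle \<open>u, v, u\<close> of length 2. A cycle of the underlying undirected graph is a
  directed cycle of length at least 3.
\<close>

definition simple_tree :: "'v pair_pre_digraph \<Rightarrow> bool" where
  "simple_tree T \<longleftrightarrow>
     pair_graph T \<and>
     Digraph_Component.connected (with_proj T) \<and>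
     \<not> (\<exists>p. pre_digraph.cycle (with_proj T) p \<and> length p \<ge> 3)"

definition distance :: "'v pair_pre_digraph \<Rightarrow> 'v \<Rightarrow> 'v \<Rightarrow> ereal" where
  "distance T u v = wf_digraph.\<mu> (with_proj T) (\<lambda>_. 1) u v"

definition children :: "'v pair_pre_digraph \<Rightarrow> 'v \<Rightarrow> 'v \<Rightarrow> 'v set" where
  "children T r v = {w. (v, w) \<in> parcs T \<and> distance T r w = distance T r v + 1}"

text \<open>A leaf of a rooted tree is a vertex without children.\<close>

definition perfect_binary_tree :: "'v pair_pre_digraph \<Rightarrow> 'v \<Rightarrow> nat \<Rightarrow> bool" where
  "perfect_binary_tree T r h \<longleftrightarrow>
     simple_tree T \<and> r \<in> pverts T \<and>
     (\<forall>v \<in> pverts T. children T r v \<noteq> {} \<longrightarrow> card (children T r v) = 2) \<and>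
     (\<forall>v \<in> pverts T. children T r v = {} \<longrightarrow> distance T r v = ereal (real h))"


section \<open>Independence number\<close>

definition independent_set :: "'v pair_pre_digraph \<Rightarrow> 'v set \<Rightarrow> bool" where
  "independent_set G A \<longleftrightarrow> A \<subseteq> pverts G \<and> (\<forall>u \<in> A. \<forall>v \<in> A. (u, v) \<notin> parcs G)"

definition independence_number :: "'v pair_pre_digraph \<Rightarrow> nat" where
  "independence_number G = Max {card A | A. independent_set G A}"


section \<open>Polynomial rings and edge ideals\<close>

text \<open>
  The type \<open>('v \<Rightarrow>\<^sub>0 nat) \<Rightarrow>\<^sub>0 'k\<close> consists of the polynomials over \<open>'k\<close> in variables indexed by all of
  \<open>'v\<close>; the carrier restricts them to those that only involve the variables in \<open>V\<close>.
\<close>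

definition mpoly_ring :: "'v set \<Rightarrow> (('v \<Rightarrow>\<^sub>0 nat) \<Rightarrow>\<^sub>0 'k::comm_ring_1) ring" where
  "mpoly_ring V =
     \<lparr>carrier = {p. \<forall>m \<in> Poly_Mapping.keys p. Poly_Mapping.keys m \<subseteq> V},
      monoid.mult = (*), one = 1, ring.zero = 0, add = (+)\<rparr>"

definition var :: "'v \<Rightarrow> (('v \<Rightarrow>\<^sub>0 nat) \<Rightarrow>\<^sub>0 'k::comm_ring_1)" where
  "var i = Poly_Mapping.single (Poly_Mapping.single i 1) 1"

definition edge_ideal :: "'v pair_pre_digraph \<Rightarrow> (('v \<Rightarrow>\<^sub>0 nat) \<Rightarrow>\<^sub>0 'k::comm_ring_1) set" where
  "edge_ideal G = Idl\<^bsub>mpoly_ring (pverts G)\<^esub> {var i * var j | i j. (i, j) \<in> parcs G}"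

lemma cring_mpoly_ring: "cring (mpoly_ring V :: (('v \<Rightarrow>\<^sub>0 nat) \<Rightarrow>\<^sub>0 'k::comm_ring_1) ring)"
proof -
  let ?C = "{p :: ('v \<Rightarrow>\<^sub>0 nat) \<Rightarrow>\<^sub>0 'k. \<forall>m \<in> Poly_Mapping.keys p. Poly_Mapping.keys m \<subseteq> V}"
  have add: "p + q \<in> ?C" if "p \<in> ?C" "q \<in> ?C" for p q
    using that subsetD[OF keys_add[of p q]] by auto
  have mult: "p * q \<in> ?C" if p: "p \<in> ?C" and q: "q \<in> ?C" for p q
  proof (intro CollectI ballI)
    fix m assume "m \<in> Poly_Mapping.keys (p * q)"
    then have "m \<in> {a + b | a b. a \<in> Poly_Mapping.keys p \<and> b \<in> Poly_Mapping.keys q}"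
      by (rule subsetD[OF keys_mult])
    then obtain a b where m: "m = a + b"
      and a: "a \<in> Poly_Mapping.keys p" and b: "b \<in> Poly_Mapping.keys q"
      by (elim CollectE exE conjE)
    have "Poly_Mapping.keys a \<subseteq> V" "Poly_Mapping.keys b \<subseteq> V"
      using p q a b by simp_all
    then show "Poly_Mapping.keys m \<subseteq> V"
      unfolding m by (intro order_trans[OF keys_add] Un_least)
  qed
  have uminus: "- p \<in> ?C" if "p \<in> ?C" for p
    using that by (simp add: keys_minus)
  let ?R = "mpoly_ring V :: (('v \<Rightarrow>\<^sub>0 nat) \<Rightarrow>\<^sub>0 'k) ring"
  have R: "carrier ?R = ?C" "monoid.mult ?R = (*)" "one ?R = 1" "ring.zero ?R = 0" "add ?R = (+)"
    by (simp_all add: mpoly_ring_def)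
  show ?thesis
  proof (rule cringI)
    show "abelian_group ?R"
    proof (rule abelian_groupI, goal_cases)
      case (1 p q)
      then show ?case unfolding R by (rule add)
    next
      case 2
      show ?case by (simp add: R)
    next
      case (3 p q s)
      show ?case unfolding R by (rule add.assoc)
    next
      case (4 p q)
      show ?case unfolding R by (rule add.commute)
    next
      case (5 p)
      show ?case unfolding R by (rule add_0_left)
    next
      case (6 p)
      then have "- p \<in> carrier ?R" unfolding R by (rule uminus)
      then show ?case
        by (rule bexI[rotated]) (simp only: R left_minus)
    qed
    show "comm_monoid ?R"
    proof (rule comm_monoidI, goal_cases)
      case (1 p q)
      then show ?case unfolding R by (rule mult)
    next
      case 2
      show ?case by (simp add: R)
    next
      case (3 p q s)
      show ?case unfolding R by (rule mult.assoc)
    next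
      case (4 p)
      show ?case unfolding R by (rule mult_1_left)
    next
      case (5 p q)
      show ?case unfolding R by (rule mult.commute)
    qed
  qed (simp only: R distrib_right)
qed

lemma var_in_carrier: "i \<in> V \<Longrightarrow> var i \<in> carrier (mpoly_ring V)"
  by (simp add: var_def mpoly_ring_def)


section \<open>Krull dimension\<close>

text \<open>The zero ring has no prime ideals, so its dimension is \<open>Sup {} = -\<infinity>\<close>.\<close>

definition krull_dim :: "('a, 'b) ring_scheme \<Rightarrow> ereal" where
  "krull_dim R =
     Sup {ereal (real n) | n. \<exists>P :: nat \<Rightarrow> 'a set.
            (\<forall>i \<le> n. primeideal (P i) R) \<and> (\<forall>i < n. P i \<subset> P (Suc i))}"

end

theory Submission
  imports Defs
begin

text \<open>
The dimension equals the independence number for every finite simple graph \<open>G\<close>. Chains of primes of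
\<open>S/I\<close> are chains of primes of \<open>S\<close> above the edge ideal \<open>I\<close>. A prime contains \<open>I\<close> exactly if it
contains an end of each edge, that is, if the variables outside of it form an independent set. For
a given independent set \<open>A\<close>, the ideal generated by the variables outside of \<open>A\<close> is therefore a prime
above \<open>I\<close>, and adding the variables in \<open>A\<close> one by one gives a chain of length \<open>card A\<close>
(\<open>prime_chain_of_independent_set\<close>).

Conversely, a chain of primes \<open>P 0 \<subset> \<dots> \<subset> P n\<close> cannot be longer than the number \<open>a\<close> of variables outside of
\<open>P 0\<close> (\<open>prime_chain_length_le\<close>). Elements \<open>x i\<close> of \<open>P (i + 1) - P i\<close> are algebraically independent
modulo \<open>P 0\<close>, because a relation between them could be followed up the chain by taking lowest terms
(\<open>power_prod_independent_mod_prime\<close>). So the \<open>N ^ n\<close> products of powers below \<open>N\<close> are linearly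
independent modulo \<open>P 0\<close>. But they lie in the span of the monomials of degree \<open>O(N)\<close> in \<open>a\<close>
variables, of which there are only \<open>O(N ^ a)\<close>, hence \<open>n \<le> a\<close>.

For the independence number of the tree, acyclicity makes each level an independent set and each
parent unique (\<open>no_path_above_level\<close>), so that level \<open>k\<close> has \<open>2 ^ k\<close> vertices. Taking every second
level, starting with the leaves, gives an independent set of the claimed size. It is largest possible:
an independent set meets two consecutive levels in at most as many vertices as the deeper one of them
has, since choosing a vertex rules out its two children (\<open>independent_two_levels\<close>).
\<close>

section \<open>Levels of a rooted tree\<close>

locale rooted_tree = pair_graph T for T :: "'v pair_pre_digraph" +
  fixes r :: 'v
  assumes tree: "simple_tree T" and root: "r \<in> pverts T"
begin

text \<open>
The distance is an infimum in the extended reals. The least length of a walk from the root is the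
same number as a natural number, which is what induction on levels needs.
\<close>

definition depth :: "'v \<Rightarrow> nat" where
  "depth v = (LEAST n. \<exists>p. awalk r p v \<and> length p = n)"

lemma depth_le: "awalk r p v \<Longrightarrow> depth v \<le> length p"
  unfolding depth_def by (rule Least_le) blast

lemma shortest_walk:
  assumes "v \<in> pverts T"
  obtains p where "awalk r p v" "length p = depth v"
proof -
  have "strongly_connected (with_proj T)"
    using tree symmetric_connected_imp_strongly_connected pair_sym_arcs
    unfolding simple_tree_def by blast
  then have "r \<rightarrow>\<^sup>*\<^bsub>with_proj T\<^esub> v"
    using root assms by (auto simp: strongly_connected_def)
  then obtain p where "awalk r p v"
    by (auto simp: reachable_awalk)
  then have "\<exists>n p. awalk r p v \<and> length p = n" by blast
  from LeastI_ex[OF this] show ?thesis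
    using that unfolding depth_def by blast
qed

lemma distance_eq_depth:
  assumes "v \<in> pverts T"
  shows "distance T r v = ereal (real (depth v))"
proof -
  have cost: "awalk_cost (\<lambda>_. 1) p = real (length p)" for p :: "('v \<times> 'v) list"
    by (induction p) (auto simp: awalk_cost_def)
  obtain p where p: "awalk r p v" "length p = depth v"
    using shortest_walk[OF assms] .
  show ?thesis
    unfolding distance_def \<mu>_def
  proof (rule antisym)
    show "(INF p\<in>{p. awalk r p v}. ereal (awalk_cost (\<lambda>_. 1) p)) \<le> ereal (real (depth v))"
      using p by (intro INF_lower2[of p]) (auto simp: cost)
    show "ereal (real (depth v)) \<le> (INF p\<in>{p. awalk r p v}. ereal (awalk_cost (\<lambda>_. 1) p))"
      by (intro INF_greatest) (auto simp: cost depth_le)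
  qed
qed

lemma depth_root: "depth r = 0"
  using depth_le[of "[]" r] root by (simp add: awalk_Nil_iff)

lemma depth_eq_0:
  assumes "v \<in> pverts T"
  shows "depth v = 0 \<longleftrightarrow> v = r"
proof
  assume "depth v = 0"
  moreover obtain p where "awalk r p v" "length p = depth v"
    using shortest_walk[OF assms] .
  ultimately show "v = r" by (simp add: awalk_Nil_iff)
qed (simp add: depth_root)

lemma depth_arc:
  assumes "(u, v) \<in> parcs T"
  shows "depth v \<le> Suc (depth u)"
proof -
  obtain p where p: "awalk r p u" "length p = depth u"
    using shortest_walk[OF in_arcsD1[OF assms]] .
  have "awalk u [(u, v)] v"
    using assms in_arcsD2 by (simp add: awalk_simps)
  from awalk_appendI[OF p(1) this] show ?thesis
    using depth_le[of "p @ [(u, v)]" v] p(2) by simp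
qed

lemma parent_exists:
  assumes "v \<in> pverts T" "depth v = Suc k"
  obtains u where "u \<in> pverts T" "(u, v) \<in> parcs T" "depth u = k"
proof -
  obtain p where p: "awalk r p v" "length p = Suc k"
    using shortest_walk[OF assms(1)] assms(2) by metis
  then obtain q e where q: "p = q @ [e]" "length q = k"
    by (cases p rule: rev_cases) auto
  define u where "u = fst e"
  have walk: "awalk r q u" and e: "e = (u, v)" "e \<in> parcs T"
    using p(1) unfolding q(1) u_def by (auto simp: awalk_simps)
  have "depth u \<le> k" "Suc k \<le> Suc (depth u)"
    using depth_le[OF walk] q(2) depth_arc[of u v] e assms(2) by simp_all
  then show ?thesis
    using e in_arcsD1 by (intro that[of u]) auto
qed

lemma awalk_of_path:
  assumes "xs \<noteq> []" "set xs \<subseteq> pverts T" "successively (\<lambda>x y. (x, y) \<in> parcs T) xs"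
  shows "awalk (hd xs) (zip xs (tl xs)) (last xs) \<and>
         pawalk_verts (hd xs) (zip xs (tl xs)) = xs"
  using assms
proof (induction xs)
  case (Cons x xs)
  then show ?case
    by (cases xs) (auto simp: awalk_simps)
qed simp

lemma no_cycle:
  assumes "distinct (x # xs)" "length xs \<ge> 2" "set (x # xs) \<subseteq> pverts T"
    and "successively (\<lambda>x y. (x, y) \<in> parcs T) (x # xs @ [x])"
  shows False
proof -
  let ?l = "x # xs @ [x]"
  let ?p = "zip ?l (tl ?l)"
  have "awalk x ?p x" "pawalk_verts x ?p = ?l"
    using awalk_of_path[of ?l] assms(3,4) by auto
  moreover have "length ?p \<ge> 3" using assms(2) by simp
  moreover have "distinct (tl ?l)" using assms(1) by auto
  moreover have "?p \<noteq> []" using assms(2) by (cases xs) auto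
  ultimately have "cycle ?p" "length ?p \<ge> 3"
    unfolding cycle_def by (metis, simp)
  then show False using tree unfolding simple_tree_def by blast
qed

text \<open>
If two distinct vertices of level \<open>k\<close> were joined by a path that nowhere comes closer to the root, then
prolonging the path at both ends by a parent either closes it to a cycle, when the two parents
agree, or gives a path of the same kind between two vertices of level \<open>k - 1\<close>. The second case
cannot continue for ever, as level \<open>0\<close> only contains the root. This one statement yields the two
facts that acyclicity is needed for: levels are independent sets, and parents are unique.
\<close>

lemma no_path_above_level:
  assumes "distinct xs" "length xs \<ge> 2" "set xs \<subseteq> pverts T"
    and "successively (\<lambda>x y. (x, y) \<in> parcs T) xs"
    and "depth (hd xs) = k" "depth (last xs) = k" "\<forall>x \<in> set xs. k \<le> depth x"
  shows False
  using assms
proof (induction k arbitrary: xs)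
  case 0
  obtain x ys where xs: "xs = x # ys" "ys \<noteq> []"
    using 0(2) by (cases xs rule: remdups_adj.cases) auto
  have "last ys \<in> pverts T"
    using 0(3) xs last_in_set by auto
  then have "x = r" "last ys = r"
    using depth_eq_0[of x] depth_eq_0[of "last ys"] 0(3,5,6) xs last_in_set[OF xs(2)] by auto
  then show False
    using 0(1) xs last_in_set[OF xs(2)] by auto
next
  case (Suc k)
  then have ne: "xs \<noteq> []" by auto
  obtain u where u: "u \<in> pverts T" "(u, hd xs) \<in> parcs T" "depth u = k"
    using parent_exists Suc.prems ne by (metis hd_in_set subsetD)
  obtain v where v: "v \<in> pverts T" "(v, last xs) \<in> parcs T" "depth v = k"
    using parent_exists Suc.prems ne by (metis last_in_set subsetD)
  have v': "(last xs, v) \<in> parcs T"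
    using v(2) arcs_symmetric by blast
  have notin: "u \<notin> set xs" "v \<notin> set xs"
    using u(3) v(3) Suc.prems(7) by auto
  have path: "successively (\<lambda>x y. (x, y) \<in> parcs T) (u # xs @ [v])"
    using Suc.prems(4) u(2) v' ne
    by (simp add: successively_append_iff successively_Cons)
  show False
  proof (cases "u = v")
    case True
    show False
      by (rule no_cycle[of u xs]) (use True Suc.prems notin path u in auto)
  next
    case False
    show False
      by (rule Suc.IH[of "u # xs @ [v]"]) (use False Suc.prems notin path u v in auto)
  qed
qed

lemma no_arc_within_level:
  assumes "(u, v) \<in> parcs T" shows "depth u \<noteq> depth v"
proof
  assume "depth u = depth v"
  then show False
    using no_path_above_level[of "[u, v]" "depth u"] assms in_arcsD1 in_arcsD2 pair_no_loops
    by fastforce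
qed

lemma parent_unique:
  assumes "(u, w) \<in> parcs T" "(v, w) \<in> parcs T"
    and "depth w = Suc (depth u)" "depth w = Suc (depth v)"
  shows "u = v"
proof (rule ccontr)
  assume "u \<noteq> v"
  moreover have "(w, v) \<in> parcs T"
    using assms(2) arcs_symmetric by blast
  ultimately show False
    using no_path_above_level[of "[u, w, v]" "depth u"] assms in_arcsD1 in_arcsD2 pair_no_loops
    by fastforce
qed

lemma children_eq:
  assumes "v \<in> pverts T"
  shows "children T r v = {w. (v, w) \<in> parcs T \<and> depth w = Suc (depth v)}"
  unfolding children_def using assms distance_eq_depth in_arcsD2
  by (auto simp: one_ereal_def)

end

section \<open>Independent sets of a perfect binary tree\<close>

lemma (in pair_graph) finite_card_independent:
  "finite {card A | A. independent_set G A}"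
proof -
  have "finite {A. independent_set G A}"
    by (rule finite_subset[of _ "Pow (pverts G)"]) (auto simp: independent_set_def)
  then show ?thesis
    unfolding setcompr_eq_image by (rule finite_imageI)
qed

locale perfect_tree = rooted_tree +
  fixes h :: nat
  assumes perfect: "perfect_binary_tree T r h"
begin

definition level :: "nat \<Rightarrow> 'a set" where
  "level k = {v \<in> pverts T. depth v = k}"

lemma finite_level: "finite (level k)"
  unfolding level_def using pair_finite_verts by simp

lemma depth_le_height:
  assumes "v \<in> pverts T" shows "depth v \<le> h"
proof -
  have ne: "depth ` pverts T \<noteq> {}" "finite (depth ` pverts T)"
    using root pair_finite_verts by auto
  then obtain u where u: "u \<in> pverts T" "depth u = Max (depth ` pverts T)"
    using Max_in[OF ne(2,1)] by (metis imageE)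
  have max: "depth w \<le> depth u" if "w \<in> pverts T" for w
    using that u ne by simp
  then have "children T r u = {}"
    using u(1) in_arcsD2 unfolding children_eq[OF u(1)] by fastforce
  then have "distance T r u = ereal (real h)"
    using perfect u(1) unfolding perfect_binary_tree_def by blast
  then show ?thesis
    using distance_eq_depth[OF u(1)] max[OF assms] by simp
qed

lemma card_children:
  assumes "v \<in> pverts T" "depth v < h"
  shows "card (children T r v) = 2"
proof -
  have "children T r v \<noteq> {}"
    using assms perfect distance_eq_depth[OF assms(1)]
    unfolding perfect_binary_tree_def by auto
  then show ?thesis
    using perfect assms unfolding perfect_binary_tree_def by blast
qed

lemma children_subset_level: "v \<in> level k \<Longrightarrow> children T r v \<subseteq> level (Suc k)"
  unfolding level_def using children_eq in_arcsD2 by auto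

lemma card_Union_children:
  assumes "B \<subseteq> level k" "k < h"
  shows "card (\<Union>v\<in>B. children T r v) = 2 * card B"
proof -
  have "finite B" using assms(1) finite_level finite_subset by blast
  moreover have "finite (children T r v)" if "v \<in> B" for v
    using that children_subset_level assms(1) finite_level finite_subset by (meson subsetD)
  moreover have "children T r u \<inter> children T r v = {}" if "u \<in> B" "v \<in> B" "u \<noteq> v" for u v
    using that assms(1) parent_unique children_eq unfolding level_def by blast
  ultimately have "card (\<Union>v\<in>B. children T r v) = (\<Sum>v\<in>B. card (children T r v))"
    by (intro card_UN_disjoint) auto
  also have "\<dots> = (\<Sum>v\<in>B. 2)"
    using assms card_children unfolding level_def by (intro sum.cong) auto
  finally show ?thesis by simp
qed

lemma card_level: "k \<le> h \<Longrightarrow> card (level k) = 2 ^ k"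
proof (induction k)
  case 0
  have "level 0 = {r}" unfolding level_def using depth_eq_0 root by auto
  then show ?case by simp
next
  case (Suc k)
  have "level (Suc k) \<subseteq> (\<Union>v\<in>level k. children T r v)"
  proof
    fix w assume w: "w \<in> level (Suc k)"
    then obtain u where "u \<in> pverts T" "(u, w) \<in> parcs T" "depth u = k"
      using parent_exists unfolding level_def by blast
    then show "w \<in> (\<Union>v\<in>level k. children T r v)"
      using w children_eq unfolding level_def by auto
  qed
  then have "level (Suc k) = (\<Union>v\<in>level k. children T r v)"
    using children_subset_level by blast
  then show ?case
    using card_Union_children[of "level k" k] Suc by simp
qed

lemma card_by_levels:
  assumes "A \<subseteq> pverts T"
  shows "card A = (\<Sum>k\<le>h. card (A \<inter> level k))"
proof -
  have card: "card (\<Union>k\<in>{..h}. A \<inter> level k) = (\<Sum>k\<le>h. card (A \<inter> level k))"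
  proof (intro card_UN_disjoint ballI impI)
    show "(A \<inter> level i) \<inter> (A \<inter> level j) = {}" if "i \<noteq> j" for i j
      using that by (auto simp: level_def)
  qed (simp_all add: finite_level)
  have Un: "(\<Union>k\<in>{..h}. A \<inter> level k) = A"
  proof
    show "A \<subseteq> (\<Union>k\<in>{..h}. A \<inter> level k)"
    proof
      fix v assume "v \<in> A"
      then have "depth v \<in> {..h}" "v \<in> A \<inter> level (depth v)"
        using assms depth_le_height[of v] by (auto simp: level_def)
      then show "v \<in> (\<Union>k\<in>{..h}. A \<inter> level k)" by (rule UN_I)
    qed
  qed blast
  show ?thesis using card unfolding Un .
qed

text \<open>
The children of the chosen vertices of level \<open>k\<close> are excluded from the independent set. There are
twice as many of them as of their parents, and they share level \<open>k + 1\<close> with the chosen vertices there.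
\<close>

lemma independent_two_levels:
  assumes "independent_set T A" "k < h"
  shows "2 * card (A \<inter> level k) + card (A \<inter> level (Suc k)) \<le> 2 ^ Suc k"
proof -
  let ?C = "\<Union>v\<in>A \<inter> level k. children T r v"
  have sub: "?C \<subseteq> level (Suc k)" using children_subset_level by blast
  then have fin: "finite ?C" using finite_level finite_subset by blast
  have disj: "?C \<inter> (A \<inter> level (Suc k)) = {}"
  proof -
    have "(v, w) \<in> parcs T" if "w \<in> children T r v" for v w
      using that unfolding children_def by blast
    then show ?thesis
      using assms(1) unfolding independent_set_def by blast
  qed
  have "2 * card (A \<inter> level k) + card (A \<inter> level (Suc k)) = card (?C \<union> (A \<inter> level (Suc k)))"
    using card_Union_children[of "A \<inter> level k" k] assms(2) card_Un_disjoint[OF fin _ disj]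
      finite_level by simp
  also have "\<dots> \<le> card (level (Suc k))"
    using sub finite_level by (intro card_mono) auto
  finally show ?thesis using card_level[of "Suc k"] assms(2) by simp
qed

lemma alternating_sum:
  "real (\<Sum>k\<le>n. if even (k + n) then 2 ^ k else 0) = (2 ^ (n + 3) - 3 + (- 1) ^ n) / 6"
proof (induction n rule: nat_induct2)
  case 0 show ?case by simp
next
  case 1 show ?case by (simp)
next
  case (step n)
  then show ?case by (simp add: field_simps power_add)
qed

text \<open>
By \<open>independent_two_levels\<close>, the levels \<open>n + 1\<close> and \<open>n + 2\<close> together contribute at most \<open>2 ^ (n + 2)\<close>, the
size of the larger one, so the bound follows by induction in steps of two.
\<close>

lemma card_independent_le:
  assumes "independent_set T A"
  shows "card A \<le> (\<Sum>k\<le>h. if even (k + h) then 2 ^ k else 0)"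
proof -
  have "(\<Sum>k\<le>n. card (A \<inter> level k)) \<le> (\<Sum>k\<le>n. if even (k + n) then 2 ^ k else 0)"
    if "n \<le> h" for n
    using that
  proof (induction n rule: nat_induct2)
    case 0
    then show ?case using card_mono[of "level 0" "A \<inter> level 0"] finite_level card_level by simp
  next
    case 1
    then show ?case using independent_two_levels[OF assms, of 0] by simp
  next
    case (step n)
    then show ?case using independent_two_levels[OF assms, of "Suc n"] by simp
  qed
  moreover have "A \<subseteq> pverts T" using assms unfolding independent_set_def by blast
  ultimately show ?thesis
    by (subst card_by_levels) blast+
qed

lemma independent_alternate_levels:
  defines "A \<equiv> {v \<in> pverts T. even (depth v + h)}"
  shows "independent_set T A" "card A = (\<Sum>k\<le>h. if even (k + h) then 2 ^ k else 0)"
proof -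
  show "independent_set T A"
    unfolding independent_set_def
  proof (intro conjI ballI notI)
    fix u v assume uv: "u \<in> A" "v \<in> A" "(u, v) \<in> parcs T"
    have "depth u = depth v \<or> depth u = Suc (depth v) \<or> depth v = Suc (depth u)"
      using depth_arc[OF uv(3)] depth_arc[OF arcs_symmetric[OF uv(3)]] by linarith
    then show False
      using uv(1,2) no_arc_within_level[OF uv(3)] unfolding A_def by auto
  qed (auto simp: A_def)
  have "A \<inter> level k = (if even (k + h) then level k else {})" for k
    unfolding A_def level_def by auto
  then have "card (A \<inter> level k) = (if even (k + h) then 2 ^ k else 0)" if "k \<le> h" for k
    using card_level[OF that] by simp
  moreover have "A \<subseteq> pverts T" unfolding A_def by blast
  ultimately show "card A = (\<Sum>k\<le>h. if even (k + h) then 2 ^ k else 0)"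
    unfolding card_by_levels[OF \<open>A \<subseteq> pverts T\<close>] by (intro sum.cong) auto
qed

lemma independence_number_eq:
  "real (independence_number T) = (2 ^ (h + 3) - 3 + (- 1) ^ h) / 6"
proof -
  have "independence_number T = (\<Sum>k\<le>h. if even (k + h) then 2 ^ k else 0)"
    unfolding independence_number_def
  proof (intro Max_eqI)
    show "finite {card A |A. independent_set T A}"
      by (rule finite_card_independent)
    show "(\<Sum>k\<le>h. if even (k + h) then 2 ^ k else 0) \<in> {card A |A. independent_set T A}"
      by (intro CollectI exI[of _ "{v \<in> pverts T. even (depth v + h)}"] conjI
          independent_alternate_levels(1) independent_alternate_levels(2)[symmetric])
  qed (use card_independent_le in blast)
  then show ?thesis using alternating_sum[of h] by simp
qed

end

section \<open>Chains of prime ideals in a quotient ring\<close>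

text \<open>
The correspondence between the ideals of \<open>R\<close> that contain \<open>I\<close> and the ideals of \<open>R Quot I\<close> is
\<open>quot_ideal_correspondence\<close>. This lemma and the next one are what is needed to restrict it to primes.
\<close>

lemma (in cring) primeideal_quot_image:
  assumes I: "ideal I R" and J: "primeideal J R" and sub: "I \<subseteq> J"
  shows "primeideal ((+>) I ` J) (R Quot I)"
proof (rule primeidealI)
  interpret J: primeideal J R by (rule J)
  interpret I: ideal I R by (rule I)
  interpret q: ring_hom_ring R "R Quot I" "(+>) I" by (rule I.rcos_ring_hom_ring)
  have Un: "\<Union> ((+>) I ` J) = J"
    using ideal_incl_iff[OF I J.is_ideal] sub by simp
  show ideal: "ideal ((+>) I ` J) (R Quot I)"
    by (rule ring_ideal_imp_quot_ideal[OF I J.is_ideal])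
  have mem: "I +> a \<in> (+>) I ` J \<longleftrightarrow> a \<in> J" if "a \<in> carrier R" for a
    using canonical_proj_vimage_mem_iff[OF I _ that, of "(+>) I ` J"] Un
      additive_subgroup.a_subset[OF ideal.axioms(1)[OF ideal]] by simp
  have surj: "\<exists>a \<in> carrier R. x = I +> a" if "x \<in> carrier (R Quot I)" for x
    using that unfolding FactRing_def A_RCOSETS_def' by auto
  show "cring (R Quot I)" by (rule I.quotient_is_cring[OF is_cring])
  show "carrier (R Quot I) \<noteq> (+>) I ` J"
  proof
    assume eq: "carrier (R Quot I) = (+>) I ` J"
    have "a \<in> J" if "a \<in> carrier R" for a
      using mem[OF that] q.hom_closed[OF that] eq by simp
    then show False using J.I_notcarr J.a_subset by blast
  qed
  fix x y
  assume x: "x \<in> carrier (R Quot I)" and y: "y \<in> carrier (R Quot I)"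
    and xy: "x \<otimes>\<^bsub>R Quot I\<^esub> y \<in> (+>) I ` J"
  obtain a where a: "a \<in> carrier R" "x = I +> a" using surj[OF x] ..
  obtain b where b: "b \<in> carrier R" "y = I +> b" using surj[OF y] ..
  have "I +> (a \<otimes> b) = x \<otimes>\<^bsub>R Quot I\<^esub> y"
    unfolding a(2) b(2) using a(1) b(1) by (rule q.hom_mult)
  then have "a \<otimes> b \<in> J"
    using xy mem[OF m_closed[OF a(1) b(1)]] by simp
  then have "a \<in> J \<or> b \<in> J"
    by (rule J.I_prime[OF a(1) b(1)])
  then show "x \<in> (+>) I ` J \<or> y \<in> (+>) I ` J"
    unfolding a(2) b(2) mem[OF a(1)] mem[OF b(1)] .
qed

lemma (in cring) primeideal_quot_Union:
  assumes I: "ideal I R" and J: "primeideal J (R Quot I)"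
  shows "primeideal (\<Union> J) R" "I \<subseteq> \<Union> J"
proof -
  interpret I: ideal I R by (rule I)
  interpret J: primeideal J "R Quot I" by (rule J)
  have sub: "J \<subseteq> carrier (R Quot I)" by (rule J.a_subset)
  have "\<Union> J = {a \<in> carrier R. I +> a \<in> J}"
    using canonical_proj_vimage_in_carrier[OF I sub] canonical_proj_vimage_mem_iff[OF I sub] by blast
  then show "primeideal (\<Union> J) R"
    using ring_hom_ring.primeideal_vimage[OF I.rcos_ring_hom_ring is_cring J] by simp
  have "I \<in> J" 
    using additive_subgroup.zero_closed[OF J.additive_subgroup_axioms]
    unfolding FactRing_def by simp
  then show "I \<subseteq> \<Union> J" by blast
qed

definition prime_chain :: "('a, 'b) ring_scheme \<Rightarrow> nat \<Rightarrow> (nat \<Rightarrow> 'a set) \<Rightarrow> bool" where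
  "prime_chain R n P \<longleftrightarrow> (\<forall>i \<le> n. primeideal (P i) R) \<and> (\<forall>i < n. P i \<subset> P (Suc i))"

lemma prime_chain_bottom:
  assumes "prime_chain R n P" "i \<le> n" shows "P 0 \<subseteq> P i"
  using assms(2)
proof (induction i)
  case (Suc i)
  then have "P 0 \<subseteq> P i" "P i \<subset> P (Suc i)"
    using assms(1) unfolding prime_chain_def by auto
  then show ?case by blast
qed simp

lemma (in cring) prime_chain_quot_iff:
  assumes I: "ideal I R"
  shows "(\<exists>P. prime_chain (R Quot I) n P) \<longleftrightarrow> (\<exists>P. prime_chain R n P \<and> I \<subseteq> P 0)"
proof
  note bij = quot_ideal_correspondence[OF I]
  assume "\<exists>P. prime_chain (R Quot I) n P"
  then obtain P where P: "prime_chain (R Quot I) n P" ..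
  have prime: "primeideal (\<Union> (P i)) R" "I \<subseteq> \<Union> (P i)" if "i \<le> n" for i
    using P that primeideal_quot_Union[OF I] unfolding prime_chain_def by blast+
  have "\<Union> (P i) \<subset> \<Union> (P (Suc i))" if "i < n" for i
  proof
    have pr: "primeideal (P i) (R Quot I)" "primeideal (P (Suc i)) (R Quot I)" "P i \<subset> P (Suc i)"
      using P that unfolding prime_chain_def by auto
    then show "\<Union> (P i) \<subseteq> \<Union> (P (Suc i))" by blast
    have eq: "(+>) I ` \<Union> J = J" if "primeideal J (R Quot I)" for J
    proof -
      have "ideal J (R Quot I)" using that by (rule primeideal.axioms(1))
      then obtain K where K: "ideal K R" "I \<subseteq> K" "J = (+>) I ` K"
        using bij unfolding bij_betw_def by blast
      then have "\<Union> J = K" using ideal_incl_iff[OF I K(1)] by simp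
      then show ?thesis using K by simp
    qed
    show "\<Union> (P i) \<noteq> \<Union> (P (Suc i))"
    proof
      assume "\<Union> (P i) = \<Union> (P (Suc i))"
      then have "(+>) I ` \<Union> (P i) = (+>) I ` \<Union> (P (Suc i))" by (rule arg_cong)
      then show False unfolding eq[OF pr(1)] eq[OF pr(2)] using pr(3) by simp
    qed
  qed
  then show "\<exists>P. prime_chain R n P \<and> I \<subseteq> P 0"
    using prime unfolding prime_chain_def by (intro exI[of _ "\<lambda>i. \<Union> (P i)"]) auto
next
  note inj = quot_ideal_correspondence[OF I, THEN bij_betw_imp_inj_on]
  assume "\<exists>P. prime_chain R n P \<and> I \<subseteq> P 0"
  then obtain P where P: "prime_chain R n P" "I \<subseteq> P 0" by blast
  have sub: "I \<subseteq> P i" if "i \<le> n" for i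
    using prime_chain_bottom[OF P(1) that] P(2) by blast
  have prime: "primeideal (P i) R" if "i \<le> n" for i
    using P(1) that unfolding prime_chain_def by blast
  have "(+>) I ` P i \<subset> (+>) I ` P (Suc i)" if "i < n" for i
  proof
    have lt: "P i \<subset> P (Suc i)" using P(1) that unfolding prime_chain_def by blast
    then show "(+>) I ` P i \<subseteq> (+>) I ` P (Suc i)" by blast
    show "(+>) I ` P i \<noteq> (+>) I ` P (Suc i)"
      using inj_onD[OF inj, of "P i" "P (Suc i)"] lt sub[of i] sub[of "Suc i"]
        primeideal.axioms(1)[OF prime[of i]] primeideal.axioms(1)[OF prime[of "Suc i"]] that by auto
  qed
  moreover have "primeideal ((+>) I ` P i) (R Quot I)" if "i \<le> n" for i
    by (rule primeideal_quot_image[OF I prime[OF that] sub[OF that]])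
  ultimately have "prime_chain (R Quot I) n (\<lambda>i. (+>) I ` P i)"
    unfolding prime_chain_def by simp
  then show "\<exists>P. prime_chain (R Quot I) n P" by (rule exI[of _ "\<lambda>i. (+>) I ` P i"])
qed

lemma (in cring) krull_dim_quot:
  assumes "ideal I R"
  shows "krull_dim (R Quot I) =
    Sup {ereal (real n) | n. \<exists>P. prime_chain R n P \<and> I \<subseteq> P 0}"
  unfolding krull_dim_def prime_chain_def[symmetric] prime_chain_quot_iff[OF assms] ..

section \<open>Monomial primes\<close>

lemma poly_mapping_eq_sum_single:
  "p = (\<Sum>m\<in>Poly_Mapping.keys p. Poly_Mapping.single m (Poly_Mapping.lookup p m))"
proof (rule poly_mapping_eqI)
  fix k
  show "Poly_Mapping.lookup p k =
    Poly_Mapping.lookup (\<Sum>m\<in>Poly_Mapping.keys p. Poly_Mapping.single m (Poly_Mapping.lookup p m)) k"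
    by (simp add: lookup_sum lookup_single when_def in_keys_iff)
qed

text \<open>
A family of maps \<open>f m\<close>, one for each monomial \<open>m\<close> and additive in the coefficient, extends to
polynomials by applying \<open>f m\<close> to the coefficient of \<open>m\<close> and summing. If \<open>f\<close> is multiplicative in
the sense of the locale below, the extension is a ring homomorphism.
\<close>

definition monomial_ext ::
  "('m \<Rightarrow> 'k \<Rightarrow> 'b::comm_ring_1) \<Rightarrow> ('m::comm_monoid_add \<Rightarrow>\<^sub>0 'k::comm_ring_1) \<Rightarrow> 'b" where
  "monomial_ext f p = (\<Sum>m\<in>Poly_Mapping.keys p. f m (Poly_Mapping.lookup p m))"

locale monomial_hom =
  fixes f :: "'m::comm_monoid_add \<Rightarrow> 'k::comm_ring_1 \<Rightarrow> 'b::comm_ring_1"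
  assumes add: "f m (a + b) = f m a + f m b"
    and mult: "f (m + n) (a * b) = f m a * f n b"
    and one: "f 0 1 = 1"
begin

lemma zero: "f m 0 = 0"
  using add[of m 0 0] by simp

lemma ext_single: "monomial_ext f (Poly_Mapping.single m a) = f m a"
  unfolding monomial_ext_def by (cases "a = 0") (simp_all add: zero)

lemma ext_add: "monomial_ext f (p + q) = monomial_ext f p + monomial_ext f q"
  unfolding monomial_ext_def by (rule setsum_keys_plus_distrib) (simp_all add: zero add)

lemma ext_zero: "monomial_ext f 0 = 0"
  unfolding monomial_ext_def by simp

lemma ext_one: "monomial_ext f 1 = 1"
  using ext_single[of 0 1] one by simp

lemma ext_sum: "monomial_ext f (sum g A) = (\<Sum>x\<in>A. monomial_ext f (g x))"
  by (induction A rule: infinite_finite_induct) (simp_all add: ext_add ext_zero)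

lemma ext_mult: "monomial_ext f (p * q) = monomial_ext f p * monomial_ext f q"
proof -
  let ?l = "\<lambda>p m. Poly_Mapping.single m (Poly_Mapping.lookup p m)"
  let ?K = "Poly_Mapping.keys"
  have "p * q = (\<Sum>m\<in>?K p. ?l p m) * (\<Sum>n\<in>?K q. ?l q n)"
    using poly_mapping_eq_sum_single[of p] poly_mapping_eq_sum_single[of q] by simp
  also have "\<dots> = (\<Sum>m\<in>?K p. \<Sum>n\<in>?K q. ?l p m * ?l q n)"
    by (rule sum_product)
  finally have "monomial_ext f (p * q) =
      (\<Sum>m\<in>?K p. \<Sum>n\<in>?K q. f m (Poly_Mapping.lookup p m) * f n (Poly_Mapping.lookup q n))"
    by (simp add: ext_sum mult_single ext_single mult)
  then show ?thesis unfolding monomial_ext_def by (simp add: sum_product)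
qed

end

lemma mpoly_ring_simps:
  "carrier (mpoly_ring V) = {p. \<forall>m \<in> Poly_Mapping.keys p. Poly_Mapping.keys m \<subseteq> V}"
  "monoid.mult (mpoly_ring V) = (*)" "one (mpoly_ring V) = 1"
  "ring.zero (mpoly_ring V) = 0" "add (mpoly_ring V) = (+)"
  by (simp_all add: mpoly_ring_def)

text \<open>
The ideal of the ring in the variables \<open>V\<close> that is generated by the variables in \<open>V \<inter> W\<close>.
\<close>

definition monomial_prime :: "'v set \<Rightarrow> 'v set \<Rightarrow> (('v \<Rightarrow>\<^sub>0 nat) \<Rightarrow>\<^sub>0 'k::field) set" where
  "monomial_prime V W =
    {p \<in> carrier (mpoly_ring V). \<forall>m \<in> Poly_Mapping.keys p. Poly_Mapping.keys m \<inter> W \<noteq> {}}"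

lemma primeideal_zero_mpoly_ring:
  "primeideal {0} (mpoly_ring (UNIV :: nat set) :: ((nat \<Rightarrow>\<^sub>0 nat) \<Rightarrow>\<^sub>0 'k::field) ring)"
proof -
  let ?R = "mpoly_ring (UNIV :: nat set) :: ((nat \<Rightarrow>\<^sub>0 nat) \<Rightarrow>\<^sub>0 'k) ring"
  interpret cring ?R by (rule cring_mpoly_ring)
  have "domain ?R"
    by unfold_locales (simp_all add: mpoly_ring_simps)
  from domain.zeroprimeideal[OF this] show ?thesis by (simp add: mpoly_ring_simps)
qed

text \<open>
Setting the variables in \<open>W\<close> to zero has this ideal as its kernel, so the ideal is prime because
polynomial rings over a field are domains. The latter rests on comparing leading monomials, so the
variables have to be linearly ordered. To this end the homomorphism also renames them to natural
numbers, through an injection \<open>e\<close> of the finite set \<open>V\<close>, and \<open>g\<close> is the induced renaming of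
monomials.
\<close>

lemma primeideal_monomial_prime:
  assumes fin: "finite V"
  shows "primeideal (monomial_prime V W) (mpoly_ring V :: (('v \<Rightarrow>\<^sub>0 nat) \<Rightarrow>\<^sub>0 'k::field) ring)"
proof -
  let ?R = "mpoly_ring V :: (('v \<Rightarrow>\<^sub>0 nat) \<Rightarrow>\<^sub>0 'k) ring"
  let ?D = "mpoly_ring (UNIV :: nat set) :: ((nat \<Rightarrow>\<^sub>0 nat) \<Rightarrow>\<^sub>0 'k) ring"
  obtain e :: "'v \<Rightarrow> nat" where e: "inj_on e V"
    using finite_imp_inj_to_nat_seg[OF fin] by blast
  define g :: "('v \<Rightarrow>\<^sub>0 nat) \<Rightarrow> (nat \<Rightarrow>\<^sub>0 nat)" where
    "g m = (\<Sum>v\<in>V. Poly_Mapping.single (e v) (Poly_Mapping.lookup m v))" for m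
  have g_add: "g (m + n) = g m + g n" for m n
    unfolding g_def by (simp add: lookup_add single_add sum.distrib)
  have g_0: "g 0 = 0" unfolding g_def by simp
  have g_e: "Poly_Mapping.lookup (g m) (e v) = Poly_Mapping.lookup m v" if "v \<in> V" for m v
  proof -
    have "Poly_Mapping.lookup (g m) (e v) = (\<Sum>u\<in>V. if u = v then Poly_Mapping.lookup m u else 0)"
      unfolding g_def lookup_sum lookup_single when_def
      using e that by (intro sum.cong) (auto simp: inj_on_def)
    then show ?thesis using that fin by simp
  qed
  have g_inj: "m = n" if "g m = g n" "Poly_Mapping.keys m \<subseteq> V" "Poly_Mapping.keys n \<subseteq> V" for m n
  proof (rule poly_mapping_eqI)
    fix v show "Poly_Mapping.lookup m v = Poly_Mapping.lookup n v"
    proof (cases "v \<in> V")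
      case True
      then show ?thesis using g_e[of v m] g_e[of v n] that(1) by simp
    next
      case False
      then have "v \<notin> Poly_Mapping.keys m" "v \<notin> Poly_Mapping.keys n" using that by auto
      then show ?thesis by (simp add: in_keys_iff)
    qed
  qed
  define f :: "('v \<Rightarrow>\<^sub>0 nat) \<Rightarrow> 'k \<Rightarrow> (nat \<Rightarrow>\<^sub>0 nat) \<Rightarrow>\<^sub>0 'k" where
    "f m a = (if Poly_Mapping.keys m \<inter> W = {} then Poly_Mapping.single (g m) a else 0)" for m a
  have keys_plus: "Poly_Mapping.keys (m + n) = Poly_Mapping.keys m \<union> Poly_Mapping.keys n"
    for m n :: "'v \<Rightarrow>\<^sub>0 nat"
    by (auto simp: in_keys_iff lookup_add)
  interpret monomial_hom f
    by unfold_locales (auto simp: f_def single_add mult_single g_add g_0 keys_plus)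
  interpret R: cring ?R by (rule cring_mpoly_ring)
  interpret D: cring ?D by (rule cring_mpoly_ring)
  interpret ring_hom_ring ?R ?D "monomial_ext f"
    by (rule ring_hom_ringI) (simp_all add: R.ring_axioms D.ring_axioms mpoly_ring_simps ext_add ext_mult ext_one)
  have "monomial_ext f p = 0 \<longleftrightarrow> (\<forall>m \<in> Poly_Mapping.keys p. Poly_Mapping.keys m \<inter> W \<noteq> {})"
    if p: "p \<in> carrier ?R" for p
  proof
    assume "\<forall>m \<in> Poly_Mapping.keys p. Poly_Mapping.keys m \<inter> W \<noteq> {}"
    then show "monomial_ext f p = 0"
      unfolding monomial_ext_def f_def by (intro sum.neutral) auto
  next
    assume 0: "monomial_ext f p = 0"
    show "\<forall>m \<in> Poly_Mapping.keys p. Poly_Mapping.keys m \<inter> W \<noteq> {}"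
    proof (rule ccontr)
      assume "\<not> (\<forall>m \<in> Poly_Mapping.keys p. Poly_Mapping.keys m \<inter> W \<noteq> {})"
      then obtain m where m: "m \<in> Poly_Mapping.keys p" "Poly_Mapping.keys m \<inter> W = {}" by blast
      have "Poly_Mapping.lookup (monomial_ext f p) (g m) =
          (\<Sum>n\<in>Poly_Mapping.keys p. if n = m then Poly_Mapping.lookup p m else 0)"
        unfolding monomial_ext_def lookup_sum
        using m g_inj[of _ m] p
        by (intro sum.cong) (auto simp: f_def lookup_single when_def mpoly_ring_simps)
      then show False using 0 m by (simp add: in_keys_iff)
    qed
  qed
  then have "monomial_prime V W = {p \<in> carrier ?R. monomial_ext f p \<in> {0}}"
    unfolding monomial_prime_def by auto
  then show ?thesis
    using primeideal_vimage[OF R.is_cring primeideal_zero_mpoly_ring] by simp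
qed

text \<open>
The variables outside of an independent set \<open>A\<close> generate a prime ideal that contains the edge ideal,
since every edge has an end outside of \<open>A\<close>. Adding the variables in \<open>A\<close> one at a time gives a strict
chain of \<open>card A\<close> further primes.
\<close>

lemma prime_chain_of_independent_set:
  fixes G :: "'v pair_pre_digraph"
  assumes fin: "finite (pverts G)" and A: "independent_set G A"
    and wf: "parcs G \<subseteq> pverts G \<times> pverts G"
  shows "\<exists>P :: nat \<Rightarrow> (('v \<Rightarrow>\<^sub>0 nat) \<Rightarrow>\<^sub>0 'k::field) set.
    prime_chain (mpoly_ring (pverts G)) (card A) P \<and> edge_ideal G \<subseteq> P 0"
proof -
  let ?V = "pverts G"
  let ?R = "mpoly_ring ?V :: (('v \<Rightarrow>\<^sub>0 nat) \<Rightarrow>\<^sub>0 'k) ring"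
  interpret R: cring ?R by (rule cring_mpoly_ring)
  have AV: "A \<subseteq> ?V" using A unfolding independent_set_def by blast
  then have finA: "finite A" using fin finite_subset by blast
  obtain a where a: "bij_betw a {0..<card A} A" using ex_bij_betw_nat_finite[OF finA] ..
  define W where "W i = (?V - A) \<union> a ` {..<i}" for i
  define P :: "nat \<Rightarrow> (('v \<Rightarrow>\<^sub>0 nat) \<Rightarrow>\<^sub>0 'k) set" where "P i = monomial_prime ?V (W i)" for i
  have prime: "primeideal (P i) ?R" for i
    unfolding P_def by (rule primeideal_monomial_prime[OF fin])
  have keys_var: "Poly_Mapping.keys (var v :: ('v \<Rightarrow>\<^sub>0 nat) \<Rightarrow>\<^sub>0 'k) = {Poly_Mapping.single v 1}" for v
    unfolding var_def by simp
  have "P i \<subset> P (Suc i)" if i: "i < card A" for i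
  proof
    have "W i \<subseteq> W (Suc i)" unfolding W_def by auto
    then show "P i \<subseteq> P (Suc i)"
      unfolding P_def monomial_prime_def by blast
    have ai: "a i \<in> A" using a i unfolding bij_betw_def by auto
    have "a i \<notin> W i"
      using a i ai unfolding W_def bij_betw_def inj_on_def by force
    then have "var (a i) \<notin> P i"
      by (simp add: P_def monomial_prime_def keys_var)
    moreover have "var (a i) \<in> P (Suc i)"
      using var_in_carrier[of "a i" ?V] ai AV by (auto simp: P_def monomial_prime_def keys_var W_def)
    ultimately show "P i \<noteq> P (Suc i)" by blast
  qed
  moreover have "edge_ideal G \<subseteq> P 0"
    unfolding edge_ideal_def
  proof (rule R.genideal_minimal[OF primeideal.axioms(1)[OF prime]], safe)
    fix i j assume ij: "(i, j) \<in> parcs G"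
    then have "i \<in> W 0 \<or> j \<in> W 0" "i \<in> ?V" "j \<in> ?V"
      using A wf unfolding W_def independent_set_def by auto
    then show "var i * var j \<in> P 0"
      unfolding P_def monomial_prime_def var_def mpoly_ring_simps mult_single
      by (auto simp: in_keys_iff lookup_add lookup_single when_def split: if_splits)
  qed
  ultimately show ?thesis
    using prime unfolding prime_chain_def by blast
qed

section \<open>Algebraic independence along a chain of primes\<close>

lemma primeideal_mpolyD:
  assumes "primeideal P (mpoly_ring V :: (('v \<Rightarrow>\<^sub>0 nat) \<Rightarrow>\<^sub>0 'k::field) ring)"
  shows "P \<subseteq> carrier (mpoly_ring V)" "0 \<in> P" "1 \<notin> P"
    and "a \<in> P \<Longrightarrow> b \<in> P \<Longrightarrow> a + b \<in> P"
    and "a \<in> P \<Longrightarrow> b \<in> carrier (mpoly_ring V) \<Longrightarrow> b * a \<in> P"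
    and "a \<in> carrier (mpoly_ring V) \<Longrightarrow> b \<in> carrier (mpoly_ring V) \<Longrightarrow> a * b \<in> P \<Longrightarrow> a \<in> P \<or> b \<in> P"
proof -
  let ?R = "mpoly_ring V :: (('v \<Rightarrow>\<^sub>0 nat) \<Rightarrow>\<^sub>0 'k::field) ring"
  interpret primeideal P ?R by (rule assms)
  show "P \<subseteq> carrier ?R" by (rule a_subset)
  show "0 \<in> P" using additive_subgroup.zero_closed[OF additive_subgroup_axioms]
    by (simp add: mpoly_ring_simps(4))
  show "1 \<notin> P"
    using one_imp_carrier I_notcarr by (auto simp: mpoly_ring_simps(3))
  show "a \<in> P \<Longrightarrow> b \<in> P \<Longrightarrow> a + b \<in> P"
    using additive_subgroup.a_closed[OF additive_subgroup_axioms, of a b]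
    by (simp add: mpoly_ring_simps(5))
  show "a \<in> P \<Longrightarrow> b \<in> carrier ?R \<Longrightarrow> b * a \<in> P"
    using I_l_closed[of a b] by (simp add: mpoly_ring_simps(2))
  show "a \<in> carrier ?R \<Longrightarrow> b \<in> carrier ?R \<Longrightarrow> a * b \<in> P \<Longrightarrow> a \<in> P \<or> b \<in> P"
    using I_prime[of a b] by (simp add: mpoly_ring_simps(2))
qed

lemma mpoly_ring_closed:
  fixes p q :: "('v \<Rightarrow>\<^sub>0 nat) \<Rightarrow>\<^sub>0 'k::field" and c :: 'k
    and g :: "'i \<Rightarrow> ('v \<Rightarrow>\<^sub>0 nat) \<Rightarrow>\<^sub>0 'k"
  shows "p \<in> carrier (mpoly_ring V) \<Longrightarrow> q \<in> carrier (mpoly_ring V) \<Longrightarrow> p * q \<in> carrier (mpoly_ring V)"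
    and "p \<in> carrier (mpoly_ring V) \<Longrightarrow> q \<in> carrier (mpoly_ring V) \<Longrightarrow> p + q \<in> carrier (mpoly_ring V)"
    and "p \<in> carrier (mpoly_ring V) \<Longrightarrow> p ^ k \<in> carrier (mpoly_ring V)"
    and "Poly_Mapping.single 0 c \<in> carrier (mpoly_ring V)"
    and "(\<And>i. i \<in> S \<Longrightarrow> g i \<in> carrier (mpoly_ring V)) \<Longrightarrow> sum g S \<in> carrier (mpoly_ring V)"
proof -
  let ?R = "mpoly_ring V :: (('v \<Rightarrow>\<^sub>0 nat) \<Rightarrow>\<^sub>0 'k::field) ring"
  interpret cring ?R by (rule cring_mpoly_ring)
  show mult: "p \<in> carrier ?R \<Longrightarrow> q \<in> carrier ?R \<Longrightarrow> p * q \<in> carrier ?R" for p q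
    using m_closed[of p q] by (simp add: mpoly_ring_simps(2))
  show add: "p \<in> carrier ?R \<Longrightarrow> q \<in> carrier ?R \<Longrightarrow> p + q \<in> carrier ?R" for p q
    using a_closed[of p q] by (simp add: mpoly_ring_simps(5))
  have one: "1 \<in> carrier ?R" using one_closed by (simp add: mpoly_ring_simps(3))
  have zero: "0 \<in> carrier ?R" using zero_closed by (simp add: mpoly_ring_simps(4))
  show "p \<in> carrier ?R \<Longrightarrow> p ^ k \<in> carrier ?R"
    by (induction k) (simp_all add: one mult)
  show "Poly_Mapping.single 0 c \<in> carrier ?R"
    by (simp add: mpoly_ring_simps(1))
  show "(\<And>i. i \<in> S \<Longrightarrow> g i \<in> carrier ?R) \<Longrightarrow> sum g S \<in> carrier ?R"
    by (induction S rule: infinite_finite_induct) (simp_all add: zero add)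
qed

lemma primeideal_mpoly_sum:
  assumes "primeideal P (mpoly_ring V :: (('v \<Rightarrow>\<^sub>0 nat) \<Rightarrow>\<^sub>0 'k::field) ring)"
    and "\<And>i. i \<in> S \<Longrightarrow> g i \<in> P"
  shows "sum g S \<in> P"
  using assms(2)
  by (induction S rule: infinite_finite_induct)
    (simp_all add: primeideal_mpolyD(2,4)[OF assms(1)])

lemma primeideal_mpoly_diff:
  assumes "primeideal P (mpoly_ring V :: (('v \<Rightarrow>\<^sub>0 nat) \<Rightarrow>\<^sub>0 'k::field) ring)"
    and "a \<in> P" "b \<in> P"
  shows "a - b \<in> P"
proof -
  have "Poly_Mapping.single 0 (- 1) * b \<in> P"
    by (rule primeideal_mpolyD(5)[OF assms(1) assms(3)]) (rule mpoly_ring_closed)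
  also have "Poly_Mapping.single 0 (- 1) * b = - b"
    by (simp add: single_uminus)
  finally show ?thesis
    using primeideal_mpolyD(4)[OF assms(1,2)] by force
qed

lemma primeideal_mpoly_power:
  assumes "primeideal P (mpoly_ring V :: (('v \<Rightarrow>\<^sub>0 nat) \<Rightarrow>\<^sub>0 'k::field) ring)"
    and "x \<in> carrier (mpoly_ring V)" "x \<notin> P"
  shows "x ^ k \<notin> P"
proof (induction k)
  case 0
  show ?case using primeideal_mpolyD(3)[OF assms(1)] by simp
next
  case (Suc k)
  then show ?case
    using primeideal_mpolyD(6)[OF assms(1,2), of "x ^ k"] mpoly_ring_closed(3)[OF assms(2)] assms(3)
    by auto
qed

text \<open>
Exponent vectors are lists, so that an induction can split off the first element of a chain together
with its exponent.
\<close>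

fun power_prod :: "'a::comm_monoid_mult list \<Rightarrow> nat list \<Rightarrow> 'a" where
  "power_prod (x # xs) (k # ks) = x ^ k * power_prod xs ks"
| "power_prod _ _ = 1"

lemma power_prod_in_carrier:
  fixes xs :: "(('v \<Rightarrow>\<^sub>0 nat) \<Rightarrow>\<^sub>0 'k::field) list"
  shows "set xs \<subseteq> carrier (mpoly_ring V) \<Longrightarrow> power_prod xs ks \<in> carrier (mpoly_ring V)"
proof (induction xs ks rule: power_prod.induct)
  case (1 x xs k ks)
  then show ?case by (simp add: mpoly_ring_closed)
qed (use mpoly_ring_closed(4)[of 1 V] in simp_all)

text \<open>
Elements picked from the successive differences of a chain of primes are algebraically independent
modulo the smallest prime. In a relation, divide by the lowest power \<open>x ^ e\<close> of the first element that
occurs; this is possible modulo \<open>P 0\<close>, as \<open>x\<close> is not in that prime. Modulo \<open>P 1\<close>, which contains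
\<open>x\<close>, only the terms with exponent \<open>e\<close> survive, and they form a relation in the remaining elements
along the rest of the chain.
\<close>

lemma power_prod_independent_mod_prime:
  fixes xs :: "(('v \<Rightarrow>\<^sub>0 nat) \<Rightarrow>\<^sub>0 'k::field) list"
  assumes "prime_chain (mpoly_ring V) (length xs) P"
    and "\<And>i. i < length xs \<Longrightarrow> xs ! i \<in> P (Suc i) - P i"
    and "finite M" "\<And>m. m \<in> M \<Longrightarrow> length m = length xs"
    and "(\<Sum>m\<in>M. Poly_Mapping.single 0 (c m) * power_prod xs m) \<in> P 0"
    and "m \<in> M"
  shows "c m = 0"
  using assms
proof (induction xs arbitrary: P M c m)
  case Nil
  then have M: "M = {[]}" and m: "m = []" by auto
  have P: "primeideal (P 0) (mpoly_ring V)" using Nil(1) unfolding prime_chain_def by simp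
  have in_P: "Poly_Mapping.single 0 (c []) \<in> P 0" using Nil(5) unfolding M by simp
  show ?case
  proof (rule ccontr)
    assume "c m \<noteq> 0"
    moreover have "Poly_Mapping.single 0 (inverse (c [])) * Poly_Mapping.single 0 (c []) \<in> P 0"
      by (rule primeideal_mpolyD(5)[OF P in_P]) (rule mpoly_ring_closed)
    ultimately have "1 \<in> P 0" by (simp add: mult_single m)
    then show False using primeideal_mpolyD(3)[OF P] by simp
  qed
next
  case (Cons x xs)
  let ?C = "carrier (mpoly_ring V :: (('v \<Rightarrow>\<^sub>0 nat) \<Rightarrow>\<^sub>0 'k) ring)"
  let ?s = "\<lambda>a. Poly_Mapping.single 0 a :: ('v \<Rightarrow>\<^sub>0 nat) \<Rightarrow>\<^sub>0 'k"
  note chain = Cons.prems(1)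
  have prime: "primeideal (P i) (mpoly_ring V)" if "i \<le> Suc (length xs)" for i
    using chain that unfolding prime_chain_def by simp
  have P0: "primeideal (P 0) (mpoly_ring V)" and P1: "primeideal (P 1) (mpoly_ring V)"
    by (simp_all add: prime)
  have P01: "P 0 \<subseteq> P 1"
    using prime_chain_bottom[OF chain, of 1] by simp
  have "y \<in> ?C" if "y \<in> set (x # xs)" for y
  proof -
    have "\<exists>i<length (x # xs). (x # xs) ! i = y"
      by (rule in_set_conv_nth[THEN iffD1, OF that])
    then obtain i where i: "i < length (x # xs)" "(x # xs) ! i = y" by blast
    then have "y \<in> P (Suc i)" using Cons.prems(2)[OF i(1)] i(2) by blast
    moreover have "P (Suc i) \<subseteq> ?C"
      using i(1) by (intro primeideal_mpolyD(1) prime) simp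
    ultimately show ?thesis by blast
  qed
  then have x: "x \<in> ?C" and xs: "set xs \<subseteq> ?C" by auto
  have x0: "x \<notin> P 0" and x1: "x \<in> P 1" using Cons.prems(2)[of 0] by auto
  show ?case
  proof (rule ccontr)
    assume "c m \<noteq> 0"
    define M' where "M' = {m \<in> M. c m \<noteq> 0}"
    have fin: "finite M'" and "m \<in> M'"
      using Cons.prems(3,6) \<open>c m \<noteq> 0\<close> unfolding M'_def by auto
    define e where "e = Min (hd ` M')"
    define L where "L = {m \<in> M'. hd m = e}"
    have e_le: "e \<le> hd m" if "m \<in> M'" for m
      unfolding e_def using that fin by simp
    have "e \<in> hd ` M'"
      unfolding e_def using fin \<open>m \<in> M'\<close> by (intro Min_in) auto
    then obtain l where l: "l \<in> L" unfolding L_def by auto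
    have cons: "m = hd m # tl m \<and> length (tl m) = length xs" if "m \<in> M'" for m
      using Cons.prems(4)[of m] that unfolding M'_def by (cases m) auto
    define t where "t m = ?s (c m) * (x ^ (hd m - e) * power_prod xs (tl m))" for m
    have carr: "t m \<in> ?C" for m
      unfolding t_def by (intro mpoly_ring_closed x power_prod_in_carrier xs)
    have term_eq: "?s (c m) * power_prod (x # xs) m = x ^ e * t m" if "m \<in> M'" for m
    proof -
      have "power_prod (x # xs) m = x ^ hd m * power_prod xs (tl m)"
        using cons[OF that] power_prod.simps(1)[of x xs "hd m" "tl m"] by metis
      also have "x ^ hd m = x ^ e * x ^ (hd m - e)"
        using e_le[OF that] by (simp add: power_add[symmetric])
      finally show ?thesis unfolding t_def by (simp add: mult_ac)
    qed
    have "(\<Sum>m\<in>M. ?s (c m) * power_prod (x # xs) m) = (\<Sum>m\<in>M'. ?s (c m) * power_prod (x # xs) m)"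
      using Cons.prems(3) unfolding M'_def by (intro sum.mono_neutral_right) auto
    also have "\<dots> = (\<Sum>m\<in>M'. x ^ e * t m)"
      by (rule sum.cong) (simp_all add: term_eq)
    also have "\<dots> = x ^ e * sum t M'" by (rule sum_distrib_left[symmetric])
    finally have "x ^ e * sum t M' \<in> P 0" using Cons.prems(5) by simp
    moreover have "sum t M' \<in> ?C" by (intro mpoly_ring_closed(5) carr)
    ultimately have "sum t M' \<in> P 0"
      using primeideal_mpolyD(6)[OF P0, of "x ^ e" "sum t M'"] mpoly_ring_closed(3)[OF x]
        primeideal_mpoly_power[OF P0 x x0] by blast
    then have "sum t M' \<in> P 1" using P01 by blast
    moreover have "sum t (M' - L) \<in> P 1"
    proof (rule primeideal_mpoly_sum[OF P1])
      fix m assume m: "m \<in> M' - L"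
      then have "hd m - e = Suc (hd m - e - 1)"
        using e_le[of m] unfolding L_def by auto
      then have "t m = (?s (c m) * (x ^ (hd m - e - 1) * power_prod xs (tl m))) * x"
        unfolding t_def by (metis (no_types, lifting) mult.assoc mult.commute power_Suc2)
      also have "\<dots> \<in> P 1"
        by (rule primeideal_mpolyD(5)[OF P1 x1])
          (intro mpoly_ring_closed x power_prod_in_carrier xs)
      finally show "t m \<in> P 1" .
    qed
    moreover have "sum t L = sum t M' - sum t (M' - L)"
      using sum.subset_diff[of L M' t] fin unfolding L_def by simp
    ultimately have "sum t L \<in> P 1"
      using primeideal_mpoly_diff[OF P1] by simp
    moreover have "sum t L = (\<Sum>m\<in>tl ` L. ?s (c (e # m)) * power_prod xs m)"
    proof -
      have "inj_on tl L"
        using cons unfolding L_def inj_on_def by (metis (mono_tags, lifting) mem_Collect_eq)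
      moreover have "c m = c (e # tl m)" "t m = ?s (c m) * power_prod xs (tl m)" if "m \<in> L" for m
        using cons[of m] that unfolding L_def t_def by auto
      ultimately show ?thesis by (simp add: sum.reindex)
    qed
    ultimately have mem: "(\<Sum>m\<in>tl ` L. ?s (c (e # m)) * power_prod xs m) \<in> P (Suc 0)" by simp
    have "c (e # tl l) = 0"
    proof (rule Cons.IH[where P = "\<lambda>i. P (Suc i)" and M = "tl ` L" and c = "\<lambda>m. c (e # m)"])
      show "prime_chain (mpoly_ring V) (length xs) (\<lambda>i. P (Suc i))"
        using chain unfolding prime_chain_def by simp
      show "xs ! i \<in> P (Suc (Suc i)) - P (Suc i)" if "i < length xs" for i
        using Cons.prems(2)[of "Suc i"] that by simp
      show "finite (tl ` L)" using fin unfolding L_def by simp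
      show "length m = length xs" if "m \<in> tl ` L" for m
        using that cons unfolding L_def by auto
    qed (use mem l in auto)
    moreover have "l = e # tl l" "c l \<noteq> 0"
      using l cons[of l] unfolding L_def M'_def by auto
    ultimately show False by simp
  qed
qed

section \<open>Counting monomials and the length of a chain\<close>

text \<open>
The family \<open>f\<close> may have repetitions, and a repetition already is a nontrivial relation; otherwise
the exchange lemma applies to its range.
\<close>

lemma (in vector_space) exists_linear_relation:
  assumes "finite B" "finite M" "card B < card M" "\<And>m. m \<in> M \<Longrightarrow> f m \<in> span B"
  shows "\<exists>c. (\<exists>m\<in>M. c m \<noteq> 0) \<and> (\<Sum>m\<in>M. c m *s f m) = 0"
proof (cases "inj_on f M")
  case True
  then have "card (f ` M) = card M" by (rule card_image)
  moreover have "f ` M \<subseteq> span B" using assms(4) by auto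
  ultimately have "dependent (f ` M)"
    using independent_span_bound[of B "f ` M"] assms(1,3) by auto
  then obtain u where u: "\<exists>v\<in>f ` M. u v \<noteq> 0" "(\<Sum>v\<in>f ` M. u v *s v) = 0"
    using dependent_finite[of "f ` M"] assms(2) by auto
  then show ?thesis
    using True by (intro exI[of _ "u \<circ> f"]) (auto simp: sum.reindex)
next
  case False
  then obtain m m' where m: "m \<in> M" "m' \<in> M" "f m = f m'" "m \<noteq> m'"
    unfolding inj_on_def by blast
  define c where "c = (\<lambda>x. if x = m then 1 else if x = m' then - 1 else (0 :: 'a))"
  have "(\<Sum>x\<in>M. c x *s f x) = (\<Sum>x\<in>{m, m'}. c x *s f x)"
    using assms(2) m by (intro sum.mono_neutral_right) (auto simp: c_def)
  also have "\<dots> = 0" using m by (simp add: c_def)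
  finally show ?thesis using m(1) by (intro exI[of _ c]) (auto simp: c_def)
qed

text \<open>
Bounding every exponent separately, and not the total degree, turns the count of bounded monomials
into a count of functions from the variables to an interval.
\<close>

definition exponents_le :: "nat \<Rightarrow> (('v \<Rightarrow>\<^sub>0 nat) \<Rightarrow>\<^sub>0 'k::zero) \<Rightarrow> bool" where
  "exponents_le d p \<longleftrightarrow> (\<forall>m \<in> Poly_Mapping.keys p. \<forall>v. Poly_Mapping.lookup m v \<le> d)"

lemma exponents_le_mono: "exponents_le d p \<Longrightarrow> d \<le> e \<Longrightarrow> exponents_le e p"
  unfolding exponents_le_def using order_trans by blast

lemma exponents_le_one: "exponents_le d (1 :: ('v \<Rightarrow>\<^sub>0 nat) \<Rightarrow>\<^sub>0 'k::comm_ring_1)"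
  unfolding exponents_le_def by simp

lemma exponents_le_mult:
  fixes p q :: "('v \<Rightarrow>\<^sub>0 nat) \<Rightarrow>\<^sub>0 'k::comm_ring_1"
  assumes "exponents_le d p" "exponents_le e q"
  shows "exponents_le (d + e) (p * q)"
  unfolding exponents_le_def
proof (intro ballI allI)
  fix m v assume "m \<in> Poly_Mapping.keys (p * q)"
  then obtain a b where "m = a + b" "a \<in> Poly_Mapping.keys p" "b \<in> Poly_Mapping.keys q"
    using keys_mult[of p q] by blast
  then show "Poly_Mapping.lookup m v \<le> d + e"
    using assms by (simp add: exponents_le_def lookup_add add_mono)
qed

lemma exponents_le_power:
  fixes p :: "('v \<Rightarrow>\<^sub>0 nat) \<Rightarrow>\<^sub>0 'k::comm_ring_1"
  assumes "exponents_le d p"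
  shows "exponents_le (k * d) (p ^ k)"
proof (induction k)
  case (Suc k)
  then show ?case using exponents_le_mult[OF assms Suc] by simp
qed (simp add: exponents_le_one)

lemma exponents_le_power_prod:
  fixes xs :: "(('v \<Rightarrow>\<^sub>0 nat) \<Rightarrow>\<^sub>0 'k::comm_ring_1) list"
  assumes "\<And>x. x \<in> set xs \<Longrightarrow> exponents_le d x" "set ks \<subseteq> {..<N}"
  shows "exponents_le (length xs * (N * d)) (power_prod xs ks)"
  using assms
proof (induction xs ks rule: power_prod.induct)
  case (1 x xs k ks)
  have x: "exponents_le d x" and k: "k \<le> N" and ks: "set ks \<subseteq> {..<N}"
    using "1.prems" by auto
  have "exponents_le (N * d) (x ^ k)"
    by (rule exponents_le_mono[OF exponents_le_power[OF x] mult_le_mono1[OF k]])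
  moreover have "exponents_le (length xs * (N * d)) (power_prod xs ks)"
    using "1.prems"(1) ks by (intro "1.IH") simp_all
  ultimately have "exponents_le (N * d + length xs * (N * d)) (x ^ k * power_prod xs ks)"
    by (rule exponents_le_mult)
  then show ?case by simp
qed (simp_all add: exponents_le_one)

lemma exponents_le_exists:
  fixes xs :: "(('v \<Rightarrow>\<^sub>0 nat) \<Rightarrow>\<^sub>0 'k::zero) list"
  shows "\<exists>d. \<forall>x \<in> set xs. exponents_le d x"
proof -
  let ?E = "\<Union>x\<in>set xs. \<Union>m\<in>Poly_Mapping.keys x. Poly_Mapping.lookup m ` Poly_Mapping.keys m"
  have "finite ?E" by simp
  then obtain d where d: "\<And>k. k \<in> ?E \<Longrightarrow> k \<le> d"
    unfolding finite_nat_set_iff_bounded_le by blast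
  have "Poly_Mapping.lookup m v \<le> d" if "x \<in> set xs" "m \<in> Poly_Mapping.keys x" for x m v
  proof (cases "v \<in> Poly_Mapping.keys m")
    case True
    then show ?thesis using that by (intro d) blast
  qed (simp add: in_keys_iff)
  then show ?thesis unfolding exponents_le_def by blast
qed

definition monomials_le :: "'v set \<Rightarrow> nat \<Rightarrow> ('v \<Rightarrow>\<^sub>0 nat) set" where
  "monomials_le A d = {m. Poly_Mapping.keys m \<subseteq> A \<and> (\<forall>v. Poly_Mapping.lookup m v \<le> d)}"

lemma card_monomials_le:
  assumes "finite A"
  shows "finite (monomials_le A d)" "card (monomials_le A d) \<le> (d + 1) ^ card A"
proof -
  let ?r = "\<lambda>m. restrict (Poly_Mapping.lookup m) A"
  have inj: "inj_on ?r (monomials_le A d)"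
  proof (rule inj_onI, rule poly_mapping_eqI)
    fix m n v
    assume mn: "m \<in> monomials_le A d" "n \<in> monomials_le A d" "?r m = ?r n"
    show "Poly_Mapping.lookup m v = Poly_Mapping.lookup n v"
    proof (cases "v \<in> A")
      case True
      then show ?thesis using fun_cong[OF mn(3), of v] by simp
    next
      case False
      then have "v \<notin> Poly_Mapping.keys m" "v \<notin> Poly_Mapping.keys n"
        using mn(1,2) unfolding monomials_le_def by auto
      then show ?thesis by (simp add: in_keys_iff)
    qed
  qed
  have sub: "?r ` monomials_le A d \<subseteq> PiE A (\<lambda>_. {..d})"
    unfolding monomials_le_def by auto
  have fin: "finite (PiE A (\<lambda>_. {..d}))" using assms by (intro finite_PiE) auto
  show "finite (monomials_le A d)"
    using inj sub fin by (rule inj_on_finite)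
  have "card (monomials_le A d) \<le> card (PiE A (\<lambda>_. {..d}))"
    using inj sub fin by (rule card_inj_on_le)
  then show "card (monomials_le A d) \<le> (d + 1) ^ card A"
    using assms by (simp add: card_PiE)
qed

interpretation mpoly: vector_space
  "\<lambda>c p. Poly_Mapping.single 0 c * p :: ('v \<Rightarrow>\<^sub>0 nat) \<Rightarrow>\<^sub>0 'k::field"
  by unfold_locales (simp_all add: algebra_simps single_add mult_single flip: mult.assoc)

text \<open>
Modulo a prime, the monomials that involve a variable of that prime vanish. Only the variables
outside of it matter, and their number limits the growth of the span in the degree.
\<close>

lemma congruent_to_monomial_span:
  fixes p :: "('v \<Rightarrow>\<^sub>0 nat) \<Rightarrow>\<^sub>0 'k::field"
  assumes P: "primeideal P (mpoly_ring V)" and p: "p \<in> carrier (mpoly_ring V)"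
    and d: "exponents_le d p" and A: "A = {v \<in> V. var v \<notin> P}"
  shows "\<exists>q \<in> mpoly.span ((\<lambda>m. Poly_Mapping.single m 1) ` monomials_le A d). p - q \<in> P"
proof -
  let ?K = "Poly_Mapping.keys p"
  let ?t = "\<lambda>m. Poly_Mapping.single m (Poly_Mapping.lookup p m)"
  let ?KA = "{m \<in> ?K. Poly_Mapping.keys m \<subseteq> A}"
  have "sum ?t ?KA \<in> mpoly.span ((\<lambda>m. Poly_Mapping.single m 1) ` monomials_le A d)"
  proof (rule mpoly.span_sum)
    fix m assume "m \<in> ?KA"
    then have "m \<in> monomials_le A d"
      using d unfolding exponents_le_def monomials_le_def by auto
    then have "Poly_Mapping.single 0 (Poly_Mapping.lookup p m) * Poly_Mapping.single m (1 :: 'k)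
        \<in> mpoly.span ((\<lambda>m. Poly_Mapping.single m 1) ` monomials_le A d)"
      by (intro mpoly.span_scale mpoly.span_base imageI)
    then show "?t m \<in> mpoly.span ((\<lambda>m. Poly_Mapping.single m 1) ` monomials_le A d)"
      by (simp add: mult_single)
  qed
  moreover have "p - sum ?t ?KA \<in> P"
  proof -
    have "sum ?t ?K = sum ?t (?K - ?KA) + sum ?t ?KA"
      by (rule sum.subset_diff) auto
    then have "p - sum ?t ?KA = sum ?t (?K - ?KA)"
      unfolding poly_mapping_eq_sum_single[symmetric] by (simp add: diff_eq_eq)
    also have "\<dots> \<in> P"
    proof (rule primeideal_mpoly_sum[OF P])
      fix m assume m: "m \<in> ?K - ?KA"
      then obtain v where v: "v \<in> Poly_Mapping.keys m" "v \<notin> A" by auto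
      have mV: "Poly_Mapping.keys m \<subseteq> V" using m p by (simp add: mpoly_ring_simps(1))
      then have var: "var v \<in> P" using v A by auto
      let ?m = "m - Poly_Mapping.single v 1"
      have "m = ?m + Poly_Mapping.single v 1"
        using v(1) by (intro poly_mapping_eqI)
          (auto simp: lookup_add lookup_minus lookup_single when_def in_keys_iff)
      then have "?t m = Poly_Mapping.single ?m (Poly_Mapping.lookup p m) * var v"
        unfolding var_def mult_single by simp
      also have "\<dots> \<in> P"
      proof (rule primeideal_mpolyD(5)[OF P var])
        have "Poly_Mapping.keys ?m \<subseteq> V"
          using mV by (auto simp: in_keys_iff lookup_minus)
        then show "Poly_Mapping.single ?m (Poly_Mapping.lookup p m) \<in> carrier (mpoly_ring V)"
          by (simp add: mpoly_ring_simps(1))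
      qed
      finally show "?t m \<in> P" .
    qed
    finally show ?thesis .
  qed
  ultimately show ?thesis by blast
qed

text \<open>
This is the bound of the Krull dimension of a polynomial ring over a field by its number of variables,
relative to a smallest prime. If a chain of length \<open>n\<close> exceeded the number \<open>a\<close> of variables
outside of \<open>P 0\<close>, the \<open>N ^ n\<close> power products with exponents below \<open>N\<close> would be linearly independent modulo
\<open>P 0\<close>, while they are congruent to elements of a space whose dimension grows only like \<open>N ^ a\<close>.
\<close>

lemma prime_chain_length_le:
  fixes P :: "nat \<Rightarrow> (('v \<Rightarrow>\<^sub>0 nat) \<Rightarrow>\<^sub>0 'k::field) set"
  assumes V: "finite V" and chain: "prime_chain (mpoly_ring V) n P"
  shows "n \<le> card {v \<in> V. var v \<notin> P 0}"
proof (rule ccontr)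
  define A where "A = {v \<in> V. var v \<notin> P 0}"
  define a where "a = card A"
  assume "\<not> n \<le> card {v \<in> V. var v \<notin> P 0}"
  then have a: "Suc a \<le> n" unfolding A_def a_def by simp
  have finA: "finite A" unfolding A_def using V by simp
  have prime: "primeideal (P i) (mpoly_ring V)" if "i \<le> n" for i
    using chain that unfolding prime_chain_def by simp
  note P0 = prime[of 0, simplified]
  have "\<exists>y. y \<in> P (Suc i) - P i" if "i < n" for i
    using chain that unfolding prime_chain_def by blast
  then obtain x where x: "\<And>i. i < n \<Longrightarrow> x i \<in> P (Suc i) - P i" by metis
  define xs where "xs = map x [0..<n]"
  have len: "length xs = n" unfolding xs_def by simp
  have nth: "xs ! i \<in> P (Suc i) - P i" if "i < length xs" for i
    using that x unfolding xs_def by simp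
  have carr: "set xs \<subseteq> carrier (mpoly_ring V)"
  proof
    fix y assume "y \<in> set xs"
    then obtain i where i: "i < n" "y = x i" unfolding xs_def by auto
    have "P (Suc i) \<subseteq> carrier (mpoly_ring V)"
      using i(1) by (intro primeideal_mpolyD(1) prime) simp
    then show "y \<in> carrier (mpoly_ring V)"
      using x[OF i(1)] i(2) by blast
  qed
  obtain d where d: "\<forall>y \<in> set xs. exponents_le d y" using exponents_le_exists by blast
  \<comment> \<open>With these values \<open>(n * N * d + 1) ^ a \<le> K ^ a * N ^ a < N ^ (a + 1)\<close>, which makes the span too small.\<close>
  define K where "K = n * d + 1"
  define N where "N = K ^ a + 1"
  define D where "D = n * (N * d)"
  define M where "M = {m. set m \<subseteq> {..<N} \<and> length m = n}"
  define B where "B = (\<lambda>m. Poly_Mapping.single m (1 :: 'k)) ` monomials_le A D"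
  have finM: "finite M" and cardM: "card M = N ^ n"
    unfolding M_def using finite_lists_length_eq[of "{..<N}" n] card_lists_length_eq[of "{..<N}" n] by auto
  have finB: "finite B" unfolding B_def using card_monomials_le(1)[OF finA] by simp
  have "card B \<le> card (monomials_le A D)"
    unfolding B_def using card_monomials_le(1)[OF finA] by (rule card_image_le)
  also have "\<dots> \<le> (D + 1) ^ a"
    unfolding a_def by (rule card_monomials_le(2)[OF finA])
  also have "\<dots> \<le> (K * N) ^ a"
  proof (rule power_mono)
    have "1 \<le> N" unfolding N_def by simp
    then show "D + 1 \<le> K * N" unfolding D_def K_def by (simp add: algebra_simps)
  qed simp
  also have "\<dots> = K ^ a * N ^ a" by (rule power_mult_distrib)
  also have "\<dots> < N * N ^ a" unfolding N_def by simp
  also have "\<dots> = N ^ Suc a" by simp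
  also have "\<dots> \<le> N ^ n" using a by (intro power_increasing) (simp_all add: N_def)
  finally have less: "card B < card M" unfolding cardM .
  have "\<exists>q \<in> mpoly.span B. power_prod xs m - q \<in> P 0" if "m \<in> M" for m
    unfolding B_def
  proof (rule congruent_to_monomial_span[OF P0 _ _ A_def])
    show "power_prod xs m \<in> carrier (mpoly_ring V)" by (rule power_prod_in_carrier[OF carr])
    show "exponents_le D (power_prod xs m)"
      using exponents_le_power_prod[of xs d m N] d that len unfolding D_def M_def by auto
  qed
  then obtain q where q: "\<And>m. m \<in> M \<Longrightarrow> q m \<in> mpoly.span B"
    "\<And>m. m \<in> M \<Longrightarrow> power_prod xs m - q m \<in> P 0" by metis
  obtain c where c: "\<exists>m\<in>M. c m \<noteq> 0" "(\<Sum>m\<in>M. Poly_Mapping.single 0 (c m) * q m) = 0"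
    using mpoly.exists_linear_relation[OF finB finM less, of q] q(1) by blast
  have "(\<Sum>m\<in>M. Poly_Mapping.single 0 (c m) * power_prod xs m) =
      (\<Sum>m\<in>M. Poly_Mapping.single 0 (c m) * (power_prod xs m - q m))"
    using c(2) by (simp add: right_diff_distrib sum_subtractf)
  also have "\<dots> \<in> P 0"
    by (intro primeideal_mpoly_sum[OF P0] primeideal_mpolyD(5)[OF P0] q(2) mpoly_ring_closed)
  finally have rel: "(\<Sum>m\<in>M. Poly_Mapping.single 0 (c m) * power_prod xs m) \<in> P 0" .
  have "c m = 0" if "m \<in> M" for m
  proof (rule power_prod_independent_mod_prime[OF _ nth finM _ rel that])
    show "prime_chain (mpoly_ring V) (length xs) P" unfolding len by (rule chain)
  qed (auto simp: M_def len)
  then show False using c(1) by blast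
qed

section \<open>The dimension of the quotient by an edge ideal\<close>

text \<open>
A prime that contains the edge ideal contains an end of every edge, so the vertices whose variables
lie outside of it form an independent set. By the preceding bound, chains upwards from this prime
have at most as many steps as this set has elements.
\<close>

lemma krull_dim_edge_ideal:
  fixes G :: "'v pair_pre_digraph"
  assumes "pair_graph G"
  shows "krull_dim (mpoly_ring (pverts G) Quot (edge_ideal G :: (('v \<Rightarrow>\<^sub>0 nat) \<Rightarrow>\<^sub>0 'k::field) set)) =
    ereal (real (independence_number G))"
proof -
  interpret pair_graph G by (rule assms)
  let ?V = "pverts G"
  let ?R = "mpoly_ring ?V :: (('v \<Rightarrow>\<^sub>0 nat) \<Rightarrow>\<^sub>0 'k) ring"
  let ?I = "edge_ideal G :: (('v \<Rightarrow>\<^sub>0 nat) \<Rightarrow>\<^sub>0 'k) set"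
  let ?gens = "{var i * var j | i j. (i, j) \<in> parcs G} :: (('v \<Rightarrow>\<^sub>0 nat) \<Rightarrow>\<^sub>0 'k) set"
  interpret R: cring ?R by (rule cring_mpoly_ring)
  have wf: "parcs G \<subseteq> ?V \<times> ?V" using in_arcsD1 in_arcsD2 by auto
  have gens: "?gens \<subseteq> carrier ?R"
    using in_arcsD1 in_arcsD2 by (auto intro!: mpoly_ring_closed(1) var_in_carrier)
  have ideal: "ideal ?I ?R"
    unfolding edge_ideal_def by (rule R.genideal_ideal[OF gens])
  have gens_I: "?gens \<subseteq> ?I"
    unfolding edge_ideal_def by (rule R.genideal_self[OF gens])
  let ?cards = "{card A | A. independent_set G A}"
  note fin = finite_card_independent
  have "independent_set G {}" by (simp add: independent_set_def)
  then have "?cards \<noteq> {}" by blast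
  from Max_in[OF fin this] obtain A where A: "independent_set G A" "card A = independence_number G"
    unfolding independence_number_def by auto
  have bound: "n \<le> independence_number G" if "prime_chain ?R n P" "?I \<subseteq> P 0" for n P
  proof -
    let ?A = "{v \<in> ?V. var v \<notin> P 0}"
    have prime: "primeideal (P 0) ?R" using that(1) unfolding prime_chain_def by simp
    have "independent_set G ?A"
      unfolding independent_set_def
    proof (intro conjI ballI notI)
      fix u v assume uv: "u \<in> ?A" "v \<in> ?A" "(u, v) \<in> parcs G"
      then have "var u * var v \<in> P 0" using gens_I that(2) by blast
      then have "var u \<in> P 0 \<or> var v \<in> P 0"
        by (rule primeideal_mpolyD(6)[OF prime, rotated 2]) (use uv in \<open>simp_all add: var_in_carrier\<close>)
      then show False using uv by simp
    qed simp
    then have "card ?A \<in> ?cards" by blast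
    then have "card ?A \<le> independence_number G"
      unfolding independence_number_def by (rule Max_ge[OF fin])
    then show ?thesis
      using prime_chain_length_le[OF pair_finite_verts that(1)] by simp
  qed
  obtain P where "prime_chain ?R (independence_number G) P" "?I \<subseteq> P 0"
    using prime_chain_of_independent_set[OF pair_finite_verts A(1) wf] A(2) by metis
  then show ?thesis
    unfolding R.krull_dim_quot[OF ideal]
    by (intro cSup_eq_maximum) (use bound in auto)
qed

theorem corollary3p4:
  fixes T :: "'v pair_pre_digraph" and r :: 'v and h :: nat
    and S :: "(('v \<Rightarrow>\<^sub>0 nat) \<Rightarrow>\<^sub>0 'k::field) ring"
    and I :: "(('v \<Rightarrow>\<^sub>0 nat) \<Rightarrow>\<^sub>0 'k) set"
  assumes "perfect_binary_tree T r h"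
    and "h > 0"
    and "S = mpoly_ring (pverts T)"
    and "I = edge_ideal T"
  shows "krull_dim (S Quot I) = ereal (real (independence_number T)) \<and>
         real (independence_number T) = (2 ^ (h + 3) - 3 + (- 1) ^ h) / 6"
proof -
  interpret pair_graph T
    using assms(1) unfolding perfect_binary_tree_def simple_tree_def by blast
  interpret perfect_tree T r h
    by unfold_locales (use assms(1) in \<open>simp_all add: perfect_binary_tree_def\<close>)
  show ?thesis
    unfolding assms(3,4)
    using krull_dim_edge_ideal[OF pair_graph_axioms] independence_number_eq by blast
qed

end
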